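(* Let $\Bbbk$ be a field, $d\ge1$, $\Lambda=\Bbbk[[x_1,\dots,x_d]]$, and let $p,q\ge1$ be integers. Let $L\subseteq\Lambda^p$ be a $\Lambda$-submodule, $\prec$ a monomial order over $\mathrm{mon}(\Lambda^p)$, and $\{s_1,\dots,s_q\}\subset\Lambda^p$ a set of non-zero elements which is a standard basis of $L$ with respect to $\prec$. Then any Schreyer family of $\{s_1,\dots,s_q\}$ with respect to $\prec$ is a standard basis of $\mathrm{syz}^\Lambda(s_1,\dots,s_q)$ with respect to the Schreyer order over $\mathrm{mon}(\Lambda^q)$ induced by $(\{s_1,\dots,s_q\},\prec)$.
   Context: Monomials of $\Lambda$ are $x^\mu=x_1^{\mu_1}\cdots x_d^{\mu_d}$, $\mu\in\mathbb N^d$; they form the free commutative monoid $[x_1,\dots,x_d]$. A monomial order over $[x_1,\dots,x_d]$ is a total order $\prec$ such that $1\prec x^\mu$ for every $x^\mu\neq 1$, and $x^\mu\prec x^{\mu'}$ implies $x^{\mu+\nu}\prec x^{\mu'+\nu}$ for all $\nu\in\mathbb N^d$. For $r\ge1$, let $e_{r,1},\dots,e_{r,r}$ be the canonical basis of $\Lambda^r$ and $\mathrm{mon}(\Lambda^r)=\{x^\mu e_{r,i}\mid \mu\in\mathbb N^d,\ 1\le i\le r\}$. A monomial order over $\mathrm{mon}(\Lambda^r)$ is a total order $\prec$ on this set which is compatible with some monomial order, also written $\prec$, over $[x_1,\dots,x_d]$: (i) $x^\mu\prec x^\nu$ implies $x^\mu e_{r,i}\prec x^\nu e_{r,i}$ for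 every $i$; (ii) $x^\mu e_{r,i}\prec x^{\mu'}e_{r,j}$ implies $x^{\mu+\nu}e_{r,i}\prec x^{\mu'+\nu}e_{r,j}$ for every $\nu\in\mathbb N^d$. For $f\in\Lambda^r$, $\mathrm{supp}(f)$ is the set of monomials having non-zero coefficient in $f$. For $f\ne0$, the leading monomial is the smallest monomial of the support, $\mathrm{lm}(f)=\min_\prec \mathrm{supp}(f)$, and the leading coefficient $\mathrm{lc}(f)\in\Bbbk$ is the coefficient of $\mathrm{lm}(f)$ in $f$. For $S\subseteq\Lambda^r$, $\mathrm{lm}(S)=\{\mathrm{lm}(f)\mid f\in S\setminus\{0\}\}$. For $T\subseteq\mathrm{mon}(\Lambda^r)$, $\langle T\rangle=\{x^\mu t\mid\mu\in\mathbb N^d,\ t\in T\}$, where $x^\mu\cdot x^\nu e_{r,i}=x^{\mu+\nu}e_{r,i}$. A subset $S$ of a submodule $L\subseteq\Lambda^r$ is a standard basis of $L$ with respect to $\prec$ if $\langle\mathrm{lm}(S)\rangle=\mathrm{lm}(L)$. Module of syzygies: $\mathrm{syz}^\Lambda(s_1,\dots,s_q)=\{(c_1,\dots,c_q)\in\Lambda^q\mid c_1s_1+\cdots+c_qs_q=0\}$. Schreyer order induced by $(S,\prec)$, $S=\{s_1,\dots,s_q\}$: the order $\prec_{\mathcal S}$ over $\mathrm{mon}(\Lambda^q)$ with $x^\mu e_{q,j}\prec_{\mathcal S}x^{\mu'}e_{q,j'}$ iff $\mathrm{lm}(x^\mu s_j)\prec\mathrm{lm}(x^{\mu'}s_{j'})$,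 or $\mathrm{lm}(x^\mu s_j)=\mathrm{lm}(x^{\mu'}s_{j'})$ and $j<j'$. It is a monomial order over $\mathrm{mon}(\Lambda^q)$. Overlapping of $S$ with respect to $\prec$: a pair $(s_j,s_{j'})$, $j\ne j'$, such that $\mathrm{lm}(s_j)=x^{\mu_j}e_{p,i}$ and $\mathrm{lm}(s_{j'})=x^{\mu_{j'}}e_{p,i}$ for the same index $i$. For $\mu,\mu'\in\mathbb N^d$, $\mathrm{lcm}(\mu,\mu')=(\max(\mu_1,\mu'_1),\dots,\max(\mu_d,\mu'_d))$. Schreyer family of $S$ with respect to $\prec$ (where $S$ is a standard basis): a set consisting of one element $\mathrm{syz}(s_j,s_{j'})$ for each overlapping $(s_j,s_{j'})$ with $1\le j<j'\le q$, where $\mathrm{syz}(s_j,s_{j'})$ is an element of $\Lambda^q$ of the form $$\frac1{\mathrm{lc}(s_j)}x^{\mathrm{lcm}(\mu_j,\mu_{j'})-\mu_j}e_{q,j}-\frac1{\mathrm{lc}(s_{j'})}x^{\mathrm{lcm}(\mu_j,\mu_{j'})-\mu_{j'}}e_{q,j'}-\sum_{k=1}^qc_ke_{q,k},\qquad (c_1,\dots,c_q)\in\Lambda^q,$$ which is non-zero, belongs to $\mathrm{syz}^\Lambda(s_1,\dots,s_q)$, and has leading monomial $x^{\mathrm{lcm}(\mu_j,\mu_{j'})-\mu_j}e_{q,j}$ with respect to $\prec_{\mathcal S}$. (Such an element exists for every overlapping when $S$ is a standard basis.) *)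

theory Defs
  imports "HOL-Analysis.Cartesian_Space"
begin

section \<open>Multivariate formal power series\<close>

text \<open>
  The variables \<open>x\<^sub>1, \<dots>, x\<^sub>d\<close> are indexed by a finite type \<open>'d\<close>, so that an exponent is a vector
  of type \<open>nat ^ 'd\<close> with the componentwise additive structure.
\<close>

typedef ('a, 'd) mfps = "UNIV :: (nat ^ 'd \<Rightarrow> 'a) set"
  morphisms mfps_coeff Abs_mfps ..

lemma mfps_coeff_Abs [simp]: "mfps_coeff (Abs_mfps f) = f"
  by (simp add: Abs_mfps_inverse)

lemma mfps_eqI: "(\<And>\<mu>. mfps_coeff f \<mu> = mfps_coeff g \<mu>) \<Longrightarrow> f = g"
  by (metis ext mfps_coeff_inject)

lemma finite_exponents_le: "finite {\<nu>. \<forall>i. \<nu> $ i \<le> \<mu> $ i}" for \<mu> :: "nat ^ 'd"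
proof -
  have "{\<nu>. \<forall>i. \<nu> $ i \<le> \<mu> $ i} \<subseteq> vec_lambda ` (\<Pi>\<^sub>E i\<in>UNIV. {..\<mu> $ i})"
  proof
    fix \<nu> :: "nat ^ 'd" assume "\<nu> \<in> {\<nu>. \<forall>i. \<nu> $ i \<le> \<mu> $ i}"
    then have "vec_nth \<nu> \<in> (\<Pi>\<^sub>E i\<in>UNIV. {..\<mu> $ i})" by auto
    then show "\<nu> \<in> vec_lambda ` (\<Pi>\<^sub>E i\<in>UNIV. {..\<mu> $ i})"
      by (metis image_eqI vec_nth_inverse)
  qed
  then show ?thesis
    by (rule finite_subset) (intro finite_imageI finite_PiE, auto)
qed

lemma finite_splittings [simp]: "finite {p. fst p + snd p = \<mu>}" for \<mu> :: "nat ^ 'd"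
proof -
  have "{p. fst p + snd p = \<mu>} \<subseteq> {\<nu>. \<forall>i. \<nu> $ i \<le> \<mu> $ i} \<times> {\<nu>. \<forall>i. \<nu> $ i \<le> \<mu> $ i}"
    by auto
  then show ?thesis
    by (rule finite_subset) (intro finite_cartesian_product finite_exponents_le)
qed

instantiation mfps :: (comm_ring_1, finite) comm_ring_1
begin

definition "0 = Abs_mfps (\<lambda>_. 0)"
definition "1 = Abs_mfps (\<lambda>\<mu>. if \<mu> = 0 then 1 else 0)"
definition "f + g = Abs_mfps (\<lambda>\<mu>. mfps_coeff f \<mu> + mfps_coeff g \<mu>)"
definition "f - g = Abs_mfps (\<lambda>\<mu>. mfps_coeff f \<mu> - mfps_coeff g \<mu>)"
definition "- f = Abs_mfps (\<lambda>\<mu>. - mfps_coeff f \<mu>)"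
definition "f * g = Abs_mfps (\<lambda>\<mu>. \<Sum>p | fst p + snd p = \<mu>. mfps_coeff f (fst p) * mfps_coeff g (snd p))"

instance
proof
  fix f g h :: "('a, 'b) mfps"
  show "f * g * h = f * (g * h)"
  proof (rule mfps_eqI)
    fix \<mu> :: "nat ^ 'b"
    let ?A = "mfps_coeff f" and ?B = "mfps_coeff g" and ?C = "mfps_coeff h"
    have "mfps_coeff (f * g * h) \<mu> =
        (\<Sum>p | fst p + snd p = \<mu>. \<Sum>r | fst r + snd r = fst p. ?A (fst r) * ?B (snd r) * ?C (snd p))"
      by (simp add: times_mfps_def case_prod_beta sum_distrib_right)
    also have "\<dots> = (\<Sum>(p, r) \<in> Sigma {p. fst p + snd p = \<mu>} (\<lambda>p. {r. fst r + snd r = fst p}).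
        ?A (fst r) * ?B (snd r) * ?C (snd p))"
      by (subst sum.Sigma) (use finite_splittings in \<open>auto simp: case_prod_beta\<close>)
    also have "\<dots> = (\<Sum>(p, r) \<in> Sigma {p. fst p + snd p = \<mu>} (\<lambda>p. {r. fst r + snd r = snd p}).
        ?A (fst p) * (?B (fst r) * ?C (snd r)))"
      by (rule sum.reindex_bij_witness[where
            i = "\<lambda>(p, r). ((fst p + fst r, snd r), (fst p, fst r))" and
            j = "\<lambda>(p, r). ((fst r, snd r + snd p), (snd r, snd p))"])
         (auto simp: ac_simps)
    also have "\<dots> = (\<Sum>p | fst p + snd p = \<mu>. \<Sum>r | fst r + snd r = snd p.
        ?A (fst p) * (?B (fst r) * ?C (snd r)))"
      by (subst sum.Sigma) (use finite_splittings in \<open>auto simp: case_prod_beta\<close>)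
    also have "\<dots> = mfps_coeff (f * (g * h)) \<mu>"
      by (simp add: times_mfps_def case_prod_beta sum_distrib_left)
    finally show "mfps_coeff (f * g * h) \<mu> = mfps_coeff (f * (g * h)) \<mu>" .
  qed
  show "f * g = g * f"
  proof (rule mfps_eqI)
    fix \<mu> :: "nat ^ 'b"
    show "mfps_coeff (f * g) \<mu> = mfps_coeff (g * f) \<mu>"
      unfolding times_mfps_def mfps_coeff_Abs
      by (rule sum.reindex_bij_witness[where i = prod.swap and j = prod.swap])
         (auto simp: ac_simps)
  qed
  show "1 * f = f"
  proof (rule mfps_eqI)
    fix \<mu> :: "nat ^ 'b"
    have "mfps_coeff (1 * f) \<mu> =
        (\<Sum>p | fst p + snd p = \<mu>. (if fst p = 0 then 1 else 0) * mfps_coeff f (snd p))"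
      by (simp add: times_mfps_def one_mfps_def case_prod_beta)
    also have "\<dots> = (\<Sum>p \<in> {(0 :: nat ^ 'b, \<mu>)}. (if fst p = 0 then 1 else 0) * mfps_coeff f (snd p))"
      by (rule sum.mono_neutral_right)
         (use finite_splittings[of \<mu>] in \<open>auto simp: case_prod_beta\<close>)
    finally show "mfps_coeff (1 * f) \<mu> = mfps_coeff f \<mu>" by simp
  qed
  show "(f + g) * h = f * h + g * h"
    by (rule mfps_eqI)
       (simp add: times_mfps_def plus_mfps_def case_prod_beta sum.distrib distrib_right)
  show "(0 :: ('a, 'b) mfps) \<noteq> 1"
  proof
    assume "(0 :: ('a, 'b) mfps) = 1"
    then have "mfps_coeff (0 :: ('a, 'b) mfps) 0 = mfps_coeff (1 :: ('a, 'b) mfps) 0" by simp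
    then show False by (simp add: zero_mfps_def one_mfps_def)
  qed
qed (auto intro!: mfps_eqI
      simp: plus_mfps_def minus_mfps_def uminus_mfps_def zero_mfps_def)

end

definition mfps_monom :: "'a::zero \<Rightarrow> nat ^ 'd \<Rightarrow> ('a, 'd) mfps" where
  "mfps_monom c \<mu> = Abs_mfps (\<lambda>\<nu>. if \<nu> = \<mu> then c else 0)"

lemma mfps_monom_mult:
  "mfps_monom a \<mu> * mfps_monom b \<nu> =
    (mfps_monom (a * b) (\<mu> + \<nu>) :: ('a::comm_ring_1, 'd::finite) mfps)"
proof (rule mfps_eqI)
  fix \<xi> :: "nat ^ 'd"
  have "mfps_coeff (mfps_monom a \<mu> * mfps_monom b \<nu> :: ('a, 'd) mfps) \<xi> =
      (\<Sum>p | fst p + snd p = \<xi>. if p = (\<mu>, \<nu>) then a * b else 0)"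
    unfolding times_mfps_def mfps_monom_def mfps_coeff_Abs
    by (rule sum.cong) (auto simp: prod_eq_iff)
  also have "\<dots> = (if \<mu> + \<nu> = \<xi> then a * b else 0)"
    using finite_splittings[of \<xi>] by (subst sum.delta) (auto simp: case_prod_beta)
  finally show "mfps_coeff (mfps_monom a \<mu> * mfps_monom b \<nu> :: ('a, 'd) mfps) \<xi> =
      mfps_coeff (mfps_monom (a * b) (\<mu> + \<nu>)) \<xi>"
    by (auto simp: mfps_monom_def)
qed

section \<open>Monomial orders\<close>

text \<open>
  \<open>\<Lambda>\<^sup>r\<close> is \<open>('a, 'd) mfps ^ 'r\<close> with scalar multiplication \<open>(*s)\<close>. Monomials \<open>x\<^sup>\<mu>\<close> are represented
  by their exponents \<open>\<mu>\<close>, and monomials \<open>x\<^sup>\<mu> e\<^sub>r\<^sub>,\<^sub>i\<close> of \<open>\<Lambda>\<^sup>r\<close> by pairs \<open>(\<mu>, i)\<close>. All orders are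
  strict.
\<close>

type_synonym ('d, 'r) mon = "(nat ^ 'd) \<times> 'r"

lemma module_mfps_vec: "module ((*s) :: 'a::comm_ring_1 \<Rightarrow> 'a ^ 'r \<Rightarrow> 'a ^ 'r)"
  by unfold_locales (simp_all add: vec_eq_iff algebra_simps)

definition strict_total_order :: "('m \<Rightarrow> 'm \<Rightarrow> bool) \<Rightarrow> bool" where
  "strict_total_order lt \<longleftrightarrow> irreflp lt \<and> transp lt \<and> totalp lt"

definition monomial_order :: "(nat ^ 'd \<Rightarrow> nat ^ 'd \<Rightarrow> bool) \<Rightarrow> bool" where
  "monomial_order lt \<longleftrightarrow>
     strict_total_order lt \<and>
     (\<forall>\<mu>. \<mu> \<noteq> 0 \<longrightarrow> lt 0 \<mu>) \<and>
     (\<forall>\<mu> \<mu>' \<nu>. lt \<mu> \<mu>' \<longrightarrow> lt (\<mu> + \<nu>) (\<mu>' + \<nu>))"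

definition module_monomial_order ::
  "(('d::finite, 'r) mon \<Rightarrow> ('d, 'r) mon \<Rightarrow> bool) \<Rightarrow> bool" where
  "module_monomial_order lt \<longleftrightarrow>
     strict_total_order lt \<and>
     (\<exists>lt\<^sub>0. monomial_order lt\<^sub>0 \<and>
        (\<forall>\<mu> \<nu> i. lt\<^sub>0 \<mu> \<nu> \<longrightarrow> lt (\<mu>, i) (\<nu>, i)) \<and>
        (\<forall>\<mu> \<mu>' \<nu> i j. lt (\<mu>, i) (\<mu>', j) \<longrightarrow> lt (\<mu> + \<nu>, i) (\<mu>' + \<nu>, j)))"

section \<open>Leading monomials and standard bases\<close>

definition supp :: "('a::zero, 'd) mfps ^ 'r \<Rightarrow> ('d::finite, 'r) mon set" where
  "supp f = {(\<mu>, i). mfps_coeff (f $ i) \<mu> \<noteq> 0}"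

text \<open>
  Leading monomials are \<^emph>\<open>smallest\<close> monomials. For \<open>f \<noteq> 0\<close> the minimum exists and is unique whenever
  \<open>lt\<close> is a monomial order; the value at \<open>f = 0\<close> is meaningless.
\<close>

definition lm ::
  "(('d::finite, 'r) mon \<Rightarrow> ('d, 'r) mon \<Rightarrow> bool) \<Rightarrow> ('a::zero, 'd) mfps ^ 'r \<Rightarrow> ('d, 'r) mon" where
  "lm lt f = (THE m. m \<in> supp f \<and> (\<forall>n \<in> supp f. n \<noteq> m \<longrightarrow> lt m n))"

definition lc ::
  "(('d::finite, 'r) mon \<Rightarrow> ('d, 'r) mon \<Rightarrow> bool) \<Rightarrow> ('a::zero, 'd) mfps ^ 'r \<Rightarrow> 'a" where
  "lc lt f = (case lm lt f of (\<mu>, i) \<Rightarrow> mfps_coeff (f $ i) \<mu>)"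

definition lm_set ::
  "(('d::finite, 'r) mon \<Rightarrow> ('d, 'r) mon \<Rightarrow> bool) \<Rightarrow>
    (('a::comm_ring_1, 'd) mfps ^ 'r) set \<Rightarrow> ('d, 'r) mon set" where
  "lm_set lt S = lm lt ` (S - {0})"

definition generated_monomials :: "('d::finite, 'r) mon set \<Rightarrow> ('d, 'r) mon set" where
  "generated_monomials T = {(\<mu> + \<nu>, i) | \<mu> \<nu> i. (\<nu>, i) \<in> T}"

definition standard_basis ::
  "(('d::finite, 'r) mon \<Rightarrow> ('d, 'r) mon \<Rightarrow> bool) \<Rightarrow>
    (('a::comm_ring_1, 'd) mfps ^ 'r) set \<Rightarrow> (('a, 'd) mfps ^ 'r) set \<Rightarrow> bool" where
  "standard_basis lt S L \<longleftrightarrow>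
     module.subspace (*s) L \<and> S \<subseteq> L \<and> generated_monomials (lm_set lt S) = lm_set lt L"

section \<open>Syzygies\<close>

text \<open>
  A family \<open>s\<^sub>1, \<dots>, s\<^sub>q\<close> is indexed by a finite linearly ordered type \<open>'q\<close>; the linear order of \<open>'q\<close>
  plays the role of the order of the indices \<open>1, \<dots>, q\<close>.
\<close>

definition syz :: "('q \<Rightarrow> ('a::comm_ring_1, 'd) mfps ^ 'p) \<Rightarrow> (('a, 'd::finite) mfps ^ 'q) set" where
  "syz s = {c. (\<Sum>k\<in>UNIV. c $ k *s s k) = 0}"

lemma subspace_syz: "module.subspace (*s) (syz s)"
proof -
  have "(\<Sum>k\<in>UNIV. (a *s c) $ k *s s k) = a *s (\<Sum>k\<in>UNIV. c $ k *s s k)" for a c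
    by (simp add: vec_eq_iff sum_distrib_left mult.assoc)
  then show ?thesis
    unfolding module.subspace_def[OF module_mfps_vec] syz_def
    by (simp add: vector_sadd_rdistrib sum.distrib)
qed

definition schreyer_order ::
  "(('d::finite, 'p) mon \<Rightarrow> ('d, 'p) mon \<Rightarrow> bool) \<Rightarrow> ('q::linorder \<Rightarrow> ('a::comm_ring_1, 'd) mfps ^ 'p) \<Rightarrow>
    ('d, 'q) mon \<Rightarrow> ('d, 'q) mon \<Rightarrow> bool" where
  "schreyer_order lt s = (\<lambda>(\<mu>, j) (\<mu>', j').
     let m = lm lt (mfps_monom 1 \<mu> *s s j); m' = lm lt (mfps_monom 1 \<mu>' *s s j')
     in lt m m' \<or> (m = m' \<and> j < j'))"

definition overlapping ::
  "(('d::finite, 'p) mon \<Rightarrow> ('d, 'p) mon \<Rightarrow> bool) \<Rightarrow> ('q \<Rightarrow> ('a::comm_ring_1, 'd) mfps ^ 'p) \<Rightarrow>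
    'q \<Rightarrow> 'q \<Rightarrow> bool" where
  "overlapping lt s j j' \<longleftrightarrow> j \<noteq> j' \<and> snd (lm lt (s j)) = snd (lm lt (s j'))"

definition exponent_lcm :: "nat ^ 'd \<Rightarrow> nat ^ 'd \<Rightarrow> nat ^ 'd" where
  "exponent_lcm \<mu> \<mu>' = (\<chi> i. max (\<mu> $ i) (\<mu>' $ i))"

text \<open>
  \<open>schreyer_syzygy lt s j j' z\<close> states that \<open>z\<close> is an admissible choice of the element
  \<open>syz(s\<^sub>j, s\<^sub>j\<^sub>')\<close>; the element is not unique.
\<close>

definition schreyer_syzygy ::
  "(('d::finite, 'p) mon \<Rightarrow> ('d, 'p) mon \<Rightarrow> bool) \<Rightarrow>
    ('q::{finite, linorder} \<Rightarrow> ('a::field, 'd) mfps ^ 'p) \<Rightarrow> 'q \<Rightarrow> 'q \<Rightarrow> ('a, 'd) mfps ^ 'q::_ \<Rightarrow> bool" where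
  "schreyer_syzygy lt s j j' z \<longleftrightarrow>
     (let \<mu> = fst (lm lt (s j)); \<mu>' = fst (lm lt (s j')); \<kappa> = exponent_lcm \<mu> \<mu>'
      in (\<exists>c. z = mfps_monom (1 / lc lt (s j)) (\<kappa> - \<mu>) *s axis j 1
                - mfps_monom (1 / lc lt (s j')) (\<kappa> - \<mu>') *s axis j' 1
                - (\<Sum>k\<in>UNIV. c k *s axis k 1)) \<and>
         z \<noteq> 0 \<and> z \<in> syz s \<and> lm (schreyer_order lt s) z = (\<kappa> - \<mu>, j))"

definition schreyer_family ::
  "(('d::finite, 'p) mon \<Rightarrow> ('d, 'p) mon \<Rightarrow> bool) \<Rightarrow>
    ('q::{finite, linorder} \<Rightarrow> ('a::field, 'd) mfps ^ 'p) \<Rightarrow> (('a, 'd) mfps ^ 'q::_) set \<Rightarrow> bool" where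
  "schreyer_family lt s F \<longleftrightarrow>
     (\<exists>z. (\<forall>j j'. j < j' \<and> overlapping lt s j j' \<longrightarrow> schreyer_syzygy lt s j j' (z j j')) \<and>
          F = {z j j' | j j'. j < j' \<and> overlapping lt s j j'})"

end

theory Submission
  imports Defs
begin

text \<open>
  Let \<open>c\<close> be a non-zero syzygy with Schreyer leading monomial \<open>(\<nu>, j)\<close> and let
  \<open>m = lm (x\<^sup>\<nu> s\<^sub>j)\<close>. Every monomial \<open>(\<alpha>, k)\<close> of \<open>c\<close> satisfies \<open>lm (x\<^sup>\<alpha> s\<^sub>k) \<succeq> m\<close>, so only those
  with equality contribute to the coefficient of \<open>m\<close> in \<open>\<Sum>\<^sub>k c\<^sub>k s\<^sub>k = 0\<close>. The contribution of
  \<open>(\<nu>, j)\<close> is non-zero and must be cancelled by some \<open>(\<alpha>, k)\<close> with \<open>k \<noteq> j\<close>, hence \<open>j < k\<close>. Then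
  \<open>m\<close> is a common multiple of \<open>lm s\<^sub>j\<close> and \<open>lm s\<^sub>k\<close>, so \<open>(\<nu>, j)\<close> is a multiple of the leading
  monomial of \<open>syz(s\<^sub>j, s\<^sub>k)\<close>. Leading monomials exist because monomial orders are well-founded,
  by Dickson's lemma.
\<close>

section \<open>Monomial orders are well-founded\<close>

text \<open>A monotone subsequence always exists; if it is non-increasing, well-ordering of the
  naturals makes it eventually constant, so a tail of it serves.\<close>

lemma nat_seq_incseq_subseq:
  fixes f :: "nat \<Rightarrow> nat"
  shows "\<exists>r. strict_mono r \<and> incseq (f \<circ> r)"
proof -
  obtain r where r: "strict_mono r" "monoseq (\<lambda>n. f (r n))"
    using seq_monosub[of f] by blast
  show ?thesis
  proof (cases "incseq (\<lambda>n. f (r n))")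
    case True
    then show ?thesis using r by (auto simp: comp_def)
  next
    case False
    then have dec: "decseq (\<lambda>n. f (r n))" using r(2) by (simp add: monoseq_iff)
    obtain N where N: "\<And>n. f (r N) \<le> f (r n)"
      using ex_has_least_nat[of "\<lambda>_. True" 0 "\<lambda>n. f (r n)"] by auto
    have "f (r (n + N)) = f (r N)" for n
      using decseqD[OF dec, of N "n + N"] N[of "n + N"] by simp
    then have "incseq (f \<circ> (\<lambda>n. r (n + N)))" by (simp add: incseq_def comp_def)
    moreover have "strict_mono (\<lambda>n. r (n + N))" using r(1) by (simp add: strict_mono_def)
    ultimately show ?thesis by blast
  qed
qed

text \<open>Dickson's lemma in subsequence form. Coordinates are treated one at a time, since
  thinning out a sequence keeps the coordinates already handled non-decreasing.\<close>

lemma dickson_subseq: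
  fixes g :: "'i \<Rightarrow> nat \<Rightarrow> nat"
  assumes "finite A"
  shows "\<exists>r. strict_mono r \<and> (\<forall>i\<in>A. incseq (g i \<circ> r))"
  using assms
proof (induction A)
  case empty
  show ?case using strict_mono_id by blast
next
  case (insert a A)
  then obtain r where r: "strict_mono r" "\<forall>i\<in>A. incseq (g i \<circ> r)" by blast
  obtain t where t: "strict_mono t" "incseq ((g a \<circ> r) \<circ> t)"
    using nat_seq_incseq_subseq by blast
  have "incseq (g i \<circ> (r \<circ> t))" if "i \<in> insert a A" for i
    using that r t strict_mono_less_eq[OF t(1)] by (auto simp: incseq_def)
  then show ?case using strict_mono_o[OF r(1) t(1)] by blast
qed

lemma module_monomial_orderD:
  assumes "module_monomial_order lt"
  shows module_monomial_order_irrefl: "\<not> lt m m"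
    and module_monomial_order_trans: "lt m n \<Longrightarrow> lt n n' \<Longrightarrow> lt m n'"
    and module_monomial_order_total: "lt m n \<or> m = n \<or> lt n m"
    and module_monomial_order_shift: "lt (\<mu>, i) (\<mu>', j) \<Longrightarrow> lt (\<nu> + \<mu>, i) (\<nu> + \<mu>', j)"
proof -
  have lt: "irreflp lt" "transp lt" "totalp lt"
    "\<And>\<mu> \<mu>' \<nu> i j. lt (\<mu>, i) (\<mu>', j) \<Longrightarrow> lt (\<mu> + \<nu>, i) (\<mu>' + \<nu>, j)"
    using assms unfolding module_monomial_order_def strict_total_order_def by blast+
  show "\<not> lt m m" using irreflpD[OF lt(1)] .
  show "lt m n \<Longrightarrow> lt n n' \<Longrightarrow> lt m n'" using transpD[OF lt(2)] .
  show "lt m n \<or> m = n \<or> lt n m" using totalpD[OF lt(3)] by blast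
  show "lt (\<mu>, i) (\<mu>', j) \<Longrightarrow> lt (\<nu> + \<mu>, i) (\<nu> + \<mu>', j)"
    using lt(4)[of \<mu> i \<mu>' j \<nu>] by (simp add: add.commute)
qed

lemma exponent_diff_add:
  fixes \<mu> \<nu> :: "nat ^ 'd"
  assumes "\<And>i. \<mu> $ i \<le> \<nu> $ i"
  shows "\<nu> - \<mu> + \<mu> = \<nu>"
  using assms by (simp add: vec_eq_iff)

text \<open>The quotient exponent \<open>\<nu> - \<mu>\<close> is 0 or lies above 0 in the
  compatible order on exponents; adding \<open>\<mu>\<close> and passing to component
  \<open>i\<close> transfers this to \<open>lt\<close>.\<close>

lemma module_monomial_order_dvd:
  fixes \<mu> \<nu> :: "nat ^ 'd::finite"
  assumes lt: "module_monomial_order lt" and le: "\<And>k. \<mu> $ k \<le> \<nu> $ k"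
  shows "(\<mu>, i) = (\<nu>, i) \<or> lt (\<mu>, i) (\<nu>, i)"
proof (cases "\<nu> - \<mu> = 0")
  case True
  then show ?thesis using exponent_diff_add[OF le] by simp
next
  case False
  obtain lt\<^sub>0 where lt0: "monomial_order lt\<^sub>0" "\<And>\<mu> \<nu> i. lt\<^sub>0 \<mu> \<nu> \<Longrightarrow> lt (\<mu>, i) (\<nu>, i)"
    using lt unfolding module_monomial_order_def by blast
  have "lt\<^sub>0 (0 + \<mu>) (\<nu> - \<mu> + \<mu>)"
    using lt0(1) False unfolding monomial_order_def by blast
  then show ?thesis using lt0(2) exponent_diff_add[OF le] by simp
qed

text \<open>By Dickson's lemma an infinite descending chain would contain a term dividing a later
  one, which then could not be smaller.\<close>

lemma wfp_module_monomial_order: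
  fixes lt :: "('d::finite, 'r::finite) mon \<Rightarrow> ('d, 'r) mon \<Rightarrow> bool"
  assumes lt: "module_monomial_order lt"
  shows "wfp lt"
proof -
  have False if desc: "\<And>n. lt (f (Suc n)) (f n)" for f :: "nat \<Rightarrow> ('d, 'r) mon"
  proof -
    \<comment> \<open>The component index joins the exponents as coordinates via its indicator functions:
      a non-decreasing indicator that starts at 1 stays at 1.\<close>
    define g :: "'d + 'r \<Rightarrow> nat \<Rightarrow> nat" where
      "g = case_sum (\<lambda>k n. fst (f n) $ k) (\<lambda>i n. of_bool (snd (f n) = i))"
    obtain r where r: "strict_mono r" "\<And>x. incseq (g x \<circ> r)"
      using dickson_subseq[of UNIV g] by auto
    have le: "g x (r 0) \<le> g x (r 1)" for x
      using incseqD[OF r(2)[of x], of 0 1] by simp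
    have "fst (f (r 0)) $ k \<le> fst (f (r 1)) $ k" for k
      using le[of "Inl k"] by (simp add: g_def)
    moreover have "snd (f (r 1)) = snd (f (r 0))"
      using le[of "Inr (snd (f (r 0)))"] by (cases "snd (f (r 1)) = snd (f (r 0))") (simp_all add: g_def)
    ultimately have "f (r 0) = f (r 1) \<or> lt (f (r 0)) (f (r 1))"
      using module_monomial_order_dvd[OF lt, of "fst (f (r 0))" "fst (f (r 1))" "snd (f (r 0))"]
      by (metis prod.collapse)
    moreover have "lt (f b) (f a)" if "a < b" for a b
      using that
      by (induction rule: less_Suc_induct) (use desc module_monomial_order_trans[OF lt] in blast)+
    then have "lt (f (r 1)) (f (r 0))" using strict_monoD[OF r(1), of 0 1] by simp
    ultimately show False
      using module_monomial_order_irrefl[OF lt] module_monomial_order_trans[OF lt] by metis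
  qed
  then show ?thesis
    unfolding wfp_def wf_iff_no_infinite_down_chain by auto
qed

section \<open>Leading monomials\<close>

lemma supp_nonempty: "f \<noteq> 0 \<Longrightarrow> supp f \<noteq> {}"
  for f :: "('a::comm_ring_1, 'd::finite) mfps ^ 'r"
  by (auto simp: supp_def vec_eq_iff zero_mfps_def intro: mfps_eqI)

lemma lm_eqI:
  assumes "module_monomial_order lt" "m \<in> supp f" "\<And>n. n \<in> supp f \<Longrightarrow> n \<noteq> m \<Longrightarrow> lt m n"
  shows "lm lt f = m"
  unfolding lm_def
proof (rule the_equality)
  show "m \<in> supp f \<and> (\<forall>n\<in>supp f. n \<noteq> m \<longrightarrow> lt m n)" using assms by blast
  fix m' assume m': "m' \<in> supp f \<and> (\<forall>n\<in>supp f. n \<noteq> m' \<longrightarrow> lt m' n)"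
  show "m' = m"
  proof (rule ccontr)
    assume "m' \<noteq> m"
    then have "lt m m'" "lt m' m" using m' assms(2,3) by auto
    then show False
      using module_monomial_order_irrefl[OF assms(1)] module_monomial_order_trans[OF assms(1)] by blast
  qed
qed

text \<open>Well-foundedness supplies a minimal element of the support and totality makes it the
  least one, so the description in \<open>lm\<close> denotes it.\<close>

lemma
  fixes f :: "('a::comm_ring_1, 'd::finite) mfps ^ 'r::finite"
  assumes lt: "module_monomial_order lt" and "f \<noteq> 0"
  shows lm_in_supp: "lm lt f \<in> supp f"
    and lm_least: "n \<in> supp f \<Longrightarrow> n \<noteq> lm lt f \<Longrightarrow> lt (lm lt f) n"
proof -
  obtain m where m: "m \<in> supp f" "\<And>n. lt n m \<Longrightarrow> n \<notin> supp f"
    using supp_nonempty[OF \<open>f \<noteq> 0\<close>] wfp_module_monomial_order[OF lt]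
    unfolding wfp_eq_minimal by blast
  then have least: "lt m n" if "n \<in> supp f" "n \<noteq> m" for n
    using that module_monomial_order_total[OF lt] by blast
  then have "lm lt f = m" using m by (intro lm_eqI[OF lt]) auto
  then show "lm lt f \<in> supp f" "n \<in> supp f \<Longrightarrow> n \<noteq> lm lt f \<Longrightarrow> lt (lm lt f) n"
    using m least by auto
qed

lemma mfps_coeff_monom_mult:
  fixes f :: "('a::comm_ring_1, 'd::finite) mfps"
  shows mfps_coeff_monom_mult_add: "mfps_coeff (mfps_monom 1 \<alpha> * f) (\<alpha> + \<beta>) = mfps_coeff f \<beta>"
    and mfps_coeff_monom_mult_nonzero:
      "mfps_coeff (mfps_monom 1 \<alpha> * f) \<xi> \<noteq> 0 \<Longrightarrow> \<exists>\<beta>. \<xi> = \<alpha> + \<beta>"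
proof -
  have "mfps_coeff (mfps_monom 1 \<alpha> * f) (\<alpha> + \<beta>) =
      (\<Sum>p | fst p + snd p = \<alpha> + \<beta>. if p = (\<alpha>, \<beta>) then mfps_coeff f \<beta> else 0)"
    unfolding times_mfps_def mfps_monom_def mfps_coeff_Abs
    by (rule sum.cong) (auto simp: prod_eq_iff)
  also have "\<dots> = mfps_coeff f \<beta>" by (subst sum.delta) auto
  finally show "mfps_coeff (mfps_monom 1 \<alpha> * f) (\<alpha> + \<beta>) = mfps_coeff f \<beta>" .
  assume "mfps_coeff (mfps_monom 1 \<alpha> * f) \<xi> \<noteq> 0"
  then obtain p where "fst p + snd p = \<xi>" "mfps_coeff (mfps_monom (1::'a) \<alpha>) (fst p) \<noteq> 0"
    unfolding times_mfps_def mfps_coeff_Abs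
    by (metis (mono_tags, lifting) mem_Collect_eq mult_zero_left sum.neutral)
  then show "\<exists>\<beta>. \<xi> = \<alpha> + \<beta>" by (auto simp: mfps_monom_def split: if_splits)
qed

text \<open>Multiplying by a monomial with coefficient 1 only translates exponents, so nothing
  cancels over any coefficient ring.\<close>

lemma supp_monom_mult:
  fixes f :: "('a::comm_ring_1, 'd::finite) mfps ^ 'r"
  shows "supp (mfps_monom 1 \<alpha> *s f) = (\<lambda>(\<beta>, i). (\<alpha> + \<beta>, i)) ` supp f"
proof (intro subset_antisym subsetI)
  fix m assume "m \<in> supp (mfps_monom 1 \<alpha> *s f)"
  then obtain \<xi> i where m: "m = (\<xi>, i)" "mfps_coeff (mfps_monom 1 \<alpha> * f $ i) \<xi> \<noteq> 0"
    by (auto simp: supp_def)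
  moreover from this obtain \<beta> where "\<xi> = \<alpha> + \<beta>" using mfps_coeff_monom_mult_nonzero by blast
  ultimately have "m = (\<alpha> + \<beta>, i)" "(\<beta>, i) \<in> supp f"
    by (auto simp: supp_def mfps_coeff_monom_mult_add)
  then show "m \<in> (\<lambda>(\<beta>, i). (\<alpha> + \<beta>, i)) ` supp f" by force
qed (auto simp: supp_def mfps_coeff_monom_mult_add)

lemma lm_monom_mult:
  fixes f :: "('a::comm_ring_1, 'd::finite) mfps ^ 'r::finite"
  assumes lt: "module_monomial_order lt" and "f \<noteq> 0"
  shows "lm lt (mfps_monom 1 \<alpha> *s f) = (\<alpha> + fst (lm lt f), snd (lm lt f))"
proof (rule lm_eqI[OF lt])
  show "(\<alpha> + fst (lm lt f), snd (lm lt f)) \<in> supp (mfps_monom 1 \<alpha> *s f)"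
    unfolding supp_monom_mult using lm_in_supp[OF assms] by (force simp: case_prod_beta)
  fix n assume n: "n \<in> supp (mfps_monom 1 \<alpha> *s f)" "n \<noteq> (\<alpha> + fst (lm lt f), snd (lm lt f))"
  then obtain \<beta> i where b: "n = (\<alpha> + \<beta>, i)" "(\<beta>, i) \<in> supp f"
    unfolding supp_monom_mult by auto
  then have "lt (fst (lm lt f), snd (lm lt f)) (\<beta>, i)"
    using lm_least[OF assms b(2)] n(2) by (metis fst_conv snd_conv prod.collapse)
  then show "lt (\<alpha> + fst (lm lt f), snd (lm lt f)) n"
    unfolding b(1) by (rule module_monomial_order_shift[OF lt])
qed

text \<open>The easy half of being a standard basis: monomial multiples of elements of
  \<open>S\<close> stay in \<open>L\<close> and have the shifted leading monomials.\<close>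

lemma generated_monomials_lm_set_subset:
  fixes S L :: "(('a::comm_ring_1, 'd::finite) mfps ^ 'r::finite) set"
  assumes lt: "module_monomial_order lt" and L: "module.subspace (*s) L" and "S \<subseteq> L"
  shows "generated_monomials (lm_set lt S) \<subseteq> lm_set lt L"
proof
  fix m assume "m \<in> generated_monomials (lm_set lt S)"
  then obtain \<mu> f where f: "f \<in> S" "f \<noteq> 0" "m = (\<mu> + fst (lm lt f), snd (lm lt f))"
    unfolding generated_monomials_def lm_set_def by (auto simp: image_iff) (metis fst_conv snd_conv)
  let ?h = "mfps_monom 1 \<mu> *s f"
  have "supp ?h \<noteq> {}" using supp_nonempty[OF f(2)] by (simp add: supp_monom_mult)
  then have "?h \<noteq> 0" by (auto simp: supp_def zero_mfps_def simp del: vector_smult_component)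
  moreover have "?h \<in> L"
    using L f(1) \<open>S \<subseteq> L\<close> by (auto simp: module.subspace_def[OF module_mfps_vec])
  moreover have "lm lt ?h = m" using lm_monom_mult[OF lt f(2)] f(3) by simp
  ultimately show "m \<in> lm_set lt L" unfolding lm_set_def by blast
qed

section \<open>The Schreyer order\<close>

text \<open>Turns the Schreyer order into a lexicographic comparison of explicit pairs, the form
  used in all later arguments.\<close>

lemma schreyer_order_iff:
  fixes s :: "'q::linorder \<Rightarrow> ('a::comm_ring_1, 'd::finite) mfps ^ 'p::finite"
  assumes "module_monomial_order lt" "\<And>j. s j \<noteq> 0"
  shows "schreyer_order lt s (\<mu>, j) (\<mu>', j') \<longleftrightarrow>
    (let m = (\<mu> + fst (lm lt (s j)), snd (lm lt (s j)));
         m' = (\<mu>' + fst (lm lt (s j')), snd (lm lt (s j')))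
     in lt m m' \<or> m = m' \<and> j < j')"
  unfolding schreyer_order_def by (simp add: lm_monom_mult[OF assms] Let_def)

text \<open>Makes the results on leading monomials available for syzygies. The exponent order
  compatible with \<open>lt\<close> also witnesses compatibility here.\<close>

lemma module_monomial_order_schreyer_order:
  fixes s :: "'q::linorder \<Rightarrow> ('a::comm_ring_1, 'd::finite) mfps ^ 'p::finite"
  assumes lt: "module_monomial_order lt" and s: "\<And>j. s j \<noteq> 0"
  shows "module_monomial_order (schreyer_order lt s)"
proof -
  note iff = schreyer_order_iff[OF lt s, unfolded Let_def]
  note irrefl = module_monomial_order_irrefl[OF lt]
    and trans = module_monomial_order_trans[OF lt]
    and total = module_monomial_order_total[OF lt]
    and shift = module_monomial_order_shift[OF lt]
  obtain lt\<^sub>0 where lt0: "monomial_order lt\<^sub>0" "\<And>\<mu> \<nu> i. lt\<^sub>0 \<mu> \<nu> \<Longrightarrow> lt (\<mu>, i) (\<nu>, i)"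
    using lt unfolding module_monomial_order_def by blast
  have "irreflp (schreyer_order lt s)"
    by (rule irreflpI) (auto simp: iff irrefl)
  moreover have "transp (schreyer_order lt s)"
  proof (rule transpI)
    fix a b c assume abc: "schreyer_order lt s a b" "schreyer_order lt s b c"
    obtain \<mu> j \<nu> k \<xi> l where eqs: "a = (\<mu>, j)" "b = (\<nu>, k)" "c = (\<xi>, l)"
      by (cases a, cases b, cases c) blast
    define A B C where "A = (\<mu> + fst (lm lt (s j)), snd (lm lt (s j)))"
      and "B = (\<nu> + fst (lm lt (s k)), snd (lm lt (s k)))"
      and "C = (\<xi> + fst (lm lt (s l)), snd (lm lt (s l)))"
    have "lt A B \<or> A = B \<and> j < k" "lt B C \<or> B = C \<and> k < l"
      using abc unfolding eqs iff A_def B_def C_def .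
    then have "lt A C \<or> A = C \<and> j < l"
      using trans[of A B C] less_trans[of j k l] by blast
    then show "schreyer_order lt s a c"
      unfolding eqs iff A_def C_def .
  qed
  moreover have "totalp (schreyer_order lt s)"
  proof (rule totalpI)
    fix a b :: "('d, 'q) mon" assume "a \<noteq> b"
    obtain \<mu> j \<nu> k where ab: "a = (\<mu>, j)" "b = (\<nu>, k)" by (cases a, cases b) blast
    define A B where "A = (\<mu> + fst (lm lt (s j)), snd (lm lt (s j)))"
      and "B = (\<nu> + fst (lm lt (s k)), snd (lm lt (s k)))"
    \<comment> \<open>If \<open>j = k\<close>, then \<open>A = B\<close> would force
      \<open>\<mu> = \<nu>\<close> by cancellation.\<close>
    have "A \<noteq> B \<or> j \<noteq> k" using \<open>a \<noteq> b\<close> unfolding ab A_def B_def by auto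
    then have "lt A B \<or> A = B \<and> j < k \<or> lt B A \<or> B = A \<and> k < j"
      using total[of A B] less_linear[of j k] by blast
    then show "schreyer_order lt s a b \<or> schreyer_order lt s b a"
      unfolding ab iff A_def B_def by blast
  qed
  moreover have "schreyer_order lt s (\<mu>, i) (\<nu>, i)" if "lt\<^sub>0 \<mu> \<nu>" for \<mu> \<nu> i
  proof -
    have "lt\<^sub>0 (\<mu> + fst (lm lt (s i))) (\<nu> + fst (lm lt (s i)))"
      using lt0(1) that unfolding monomial_order_def by blast
    then show ?thesis unfolding iff using lt0(2) by blast
  qed
  moreover have "schreyer_order lt s (\<mu> + \<nu>, i) (\<mu>' + \<nu>, j)"
    if "schreyer_order lt s (\<mu>, i) (\<mu>', j)" for \<mu> \<mu>' \<nu> i j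
  proof -
    have "\<mu> + \<nu> + \<alpha> = \<nu> + (\<mu> + \<alpha>)" for \<mu> \<alpha> :: "nat ^ 'd" by (simp add: ac_simps)
    then show ?thesis
      using that shift[of "\<mu> + fst (lm lt (s i))" "snd (lm lt (s i))"
          "\<mu>' + fst (lm lt (s j))" "snd (lm lt (s j))" \<nu>]
      unfolding iff by auto
  qed
  ultimately show ?thesis
    using lt0(1) unfolding module_monomial_order_def strict_total_order_def by blast
qed

section \<open>Leading monomials of syzygies\<close>

lemma mfps_coeff_sum:
  "mfps_coeff (\<Sum>k\<in>A. f k) \<mu> = (\<Sum>k\<in>A. mfps_coeff (f k :: ('a::comm_ring_1, 'd::finite) mfps) \<mu>)"
  by (induction A rule: infinite_finite_induct) (simp_all add: zero_mfps_def plus_mfps_def)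

text \<open>The first two conclusions make \<open>(j, k)\<close> one of the pairs indexing a
  Schreyer family; the third provides the common multiple.\<close>

lemma syzygy_lm_cancelled:
  fixes s :: "'q::{finite, linorder} \<Rightarrow> ('a::field, 'd::finite) mfps ^ 'p::finite"
  assumes lt: "module_monomial_order lt" and s: "\<And>j. s j \<noteq> 0"
    and c: "c \<in> syz s" "c \<noteq> 0" and lmc: "lm (schreyer_order lt s) c = (\<nu>, j)"
  obtains \<alpha> k where "j < k" "snd (lm lt (s k)) = snd (lm lt (s j))"
    "\<alpha> + fst (lm lt (s k)) = \<nu> + fst (lm lt (s j))"
proof -
  note S = module_monomial_order_schreyer_order[of lt s, OF lt s]
  note iff = schreyer_order_iff[of lt s, OF lt s, unfolded Let_def]
  \<comment> \<open>\<open>(\<xi>, i)\<close> is the monomial \<open>m\<close> of the outline;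
    summing \<open>t k p\<close> over the splittings \<open>p\<close> of \<open>\<xi>\<close> gives
    its coefficient in \<open>c $ k *s s k\<close>.\<close>
  define \<xi> i where "\<xi> = \<nu> + fst (lm lt (s j))" and "i = snd (lm lt (s j))"
  define t where "t k p = mfps_coeff (c $ k) (fst p) * mfps_coeff (s k $ i) (snd p)" for k p
  \<comment> \<open>A squeeze: leastness of \<open>(\<nu>, j)\<close> in \<open>c\<close> bounds the
    shifted leading monomial of \<open>s k\<close> below by \<open>(\<xi>, i)\<close>, and leastness
    of \<open>lm lt (s k)\<close> bounds it above.\<close>
  have contrib: "(\<alpha> + fst (lm lt (s k)), snd (lm lt (s k))) = (\<xi>, i) \<and> (\<beta>, i) = lm lt (s k) \<and>
      (k = j \<longrightarrow> \<alpha> = \<nu>) \<and> (k \<noteq> j \<longrightarrow> j < k)"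
    if nz: "t k (\<alpha>, \<beta>) \<noteq> 0" and sum: "\<alpha> + \<beta> = \<xi>" for k \<alpha> \<beta>
  proof -
    let ?n = "(\<alpha> + fst (lm lt (s k)), snd (lm lt (s k)))"
    have supp: "(\<alpha>, k) \<in> supp c" "(\<beta>, i) \<in> supp (s k)" using nz by (auto simp: t_def supp_def)
    have c_le: "(\<alpha>, k) = (\<nu>, j) \<or> schreyer_order lt s (\<nu>, j) (\<alpha>, k)"
      using lm_least[OF S c(2) supp(1)] lmc by auto
    have le: "?n = (\<xi>, i) \<or> lt (\<xi>, i) ?n"
      using c_le unfolding iff \<xi>_def i_def by auto
    have s_le: "(\<beta>, i) = lm lt (s k) \<or> lt ?n (\<xi>, i)"
      using lm_least[OF lt s supp(2)] sum
        module_monomial_order_shift[OF lt, of "fst (lm lt (s k))" "snd (lm lt (s k))" \<beta> i \<alpha>] by auto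
    have lm: "(\<beta>, i) = lm lt (s k)"
      using le s_le module_monomial_order_irrefl[OF lt] module_monomial_order_trans[OF lt] by metis
    then have n: "?n = (\<xi>, i)" using sum by (metis fst_conv snd_conv)
    \<comment> \<open>With the leading monomials tied, \<open>c_le\<close> can hold for
      \<open>k \<noteq> j\<close> only through the index tie-break.\<close>
    have "k \<noteq> j \<longrightarrow> j < k"
      using c_le n module_monomial_order_irrefl[OF lt] unfolding iff \<xi>_def i_def by auto
    moreover have "k = j \<longrightarrow> \<alpha> = \<nu>" using n by (auto simp: \<xi>_def)
    ultimately show ?thesis using lm n by blast
  qed
  have "\<exists>k p. k \<noteq> j \<and> fst p + snd p = \<xi> \<and> t k p \<noteq> 0"
  proof (rule ccontr)
    assume none: "\<not> ?thesis"
    have "0 = mfps_coeff ((\<Sum>k\<in>UNIV. c $ k *s s k) $ i) \<xi>"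
      using c(1) by (simp add: syz_def zero_mfps_def)
    also have "\<dots> = (\<Sum>k\<in>UNIV. \<Sum>p | fst p + snd p = \<xi>. t k p)"
      by (simp add: mfps_coeff_sum times_mfps_def t_def)
    also have "\<dots> = (\<Sum>k\<in>{j}. \<Sum>p | fst p + snd p = \<xi>. t k p)"
      using none by (intro sum.mono_neutral_right) (auto intro!: sum.neutral)
    \<comment> \<open>For \<open>k = j\<close>, \<open>contrib\<close> leaves only the splitting
      into the two leading exponents.\<close>
    also have "\<dots> = (\<Sum>p\<in>{(\<nu>, fst (lm lt (s j)))}. t j p)"
    proof -
      have "(\<Sum>p | fst p + snd p = \<xi>. t j p) = (\<Sum>p\<in>{(\<nu>, fst (lm lt (s j)))}. t j p)"
      proof (intro sum.mono_neutral_right ballI)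
        fix p assume p: "p \<in> {p. fst p + snd p = \<xi>} - {(\<nu>, fst (lm lt (s j)))}"
        show "t j p = 0"
          using contrib[of j "fst p" "snd p"] p by (cases p) (auto, metis fst_conv)
      qed (auto simp: \<xi>_def)
      then show ?thesis by simp
    qed
    \<comment> \<open>The surviving term is the product of the leading coefficients of
      \<open>c\<close> and \<open>s j\<close>, non-zero in a field.\<close>
    also have "\<dots> \<noteq> 0"
      using lm_in_supp[OF S c(2)] lm_in_supp[OF lt s, of j] lmc
      by (auto simp: t_def supp_def i_def)
    finally show False by simp
  qed
  then obtain k p where "k \<noteq> j" "fst p + snd p = \<xi>" "t k (fst p, snd p) \<noteq> 0" by auto
  with contrib[of k "fst p" "snd p"] show thesis
    by (intro that[of k "fst p"]) (auto simp: \<xi>_def i_def)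
qed

text \<open>The common value of both sides lies above \<open>\<mu>\<close> and
  \<open>\<mu>'\<close>, hence above their maximum; subtracting \<open>\<mu>\<close> leaves
  \<open>\<nu>\<close>.\<close>

lemma exponent_lcm_le:
  assumes "\<nu> + \<mu> = \<alpha> + \<mu>'"
  shows "(exponent_lcm \<mu> \<mu>' - \<mu>) $ i \<le> \<nu> $ i"
proof -
  have "\<nu> $ i + \<mu> $ i = \<alpha> $ i + \<mu>' $ i" using assms by (metis vector_add_component)
  then show ?thesis by (simp add: exponent_lcm_def)
qed

theorem theorem4p3:
  fixes L :: "(('k::field, 'd::finite) mfps ^ 'p::finite) set"
    and lt :: "('d, 'p) mon \<Rightarrow> ('d, 'p) mon \<Rightarrow> bool"
    and s :: "'q::{finite, linorder} \<Rightarrow> ('k, 'd) mfps ^ 'p"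
    and F :: "(('k, 'd) mfps ^ 'q::_) set"
  assumes "module.subspace (*s) L"
    and "module_monomial_order lt"
    and "\<And>j. s j \<noteq> 0"
    and "standard_basis lt (range s) L"
    and "schreyer_family lt s F"
  shows "standard_basis (schreyer_order lt s) F (syz s)"
proof -
  note lt = assms(2) and s = assms(3)
  note S = module_monomial_order_schreyer_order[of lt s, OF lt s]
  obtain z where z: "\<And>j k. j < k \<Longrightarrow> overlapping lt s j k \<Longrightarrow> schreyer_syzygy lt s j k (z j k)"
    and F: "F = {z j k | j k. j < k \<and> overlapping lt s j k}"
    using assms(5) unfolding schreyer_family_def by blast
  have "F \<subseteq> syz s" using z unfolding F schreyer_syzygy_def Let_def by blast
  moreover have "lm_set (schreyer_order lt s) (syz s) \<subseteq>
      generated_monomials (lm_set (schreyer_order lt s) F)"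
  proof
    fix m assume "m \<in> lm_set (schreyer_order lt s) (syz s)"
    then obtain c where c: "c \<in> syz s" "c \<noteq> 0" and "m = lm (schreyer_order lt s) c"
      unfolding lm_set_def by blast
    moreover obtain \<nu> j where m: "m = (\<nu>, j)" by (cases m)
    ultimately have lmc: "lm (schreyer_order lt s) c = (\<nu>, j)" by simp
    obtain \<alpha> k where k: "j < k" "snd (lm lt (s k)) = snd (lm lt (s j))"
      "\<alpha> + fst (lm lt (s k)) = \<nu> + fst (lm lt (s j))"
      using syzygy_lm_cancelled[OF lt s c lmc] by blast
    \<comment> \<open>The exponent of the leading monomial prescribed for
      \<open>z j k\<close>.\<close>
    define \<delta> where
      "\<delta> = exponent_lcm (fst (lm lt (s j))) (fst (lm lt (s k))) - fst (lm lt (s j))"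
    have ov: "overlapping lt s j k" using k by (simp add: overlapping_def)
    then have zjk: "z j k \<noteq> 0" "lm (schreyer_order lt s) (z j k) = (\<delta>, j)"
      using z[OF k(1)] unfolding schreyer_syzygy_def Let_def \<delta>_def by blast+
    moreover have "z j k \<in> F" using k(1) ov unfolding F by blast
    ultimately have "(\<delta>, j) \<in> lm_set (schreyer_order lt s) F"
      unfolding lm_set_def by force
    \<comment> \<open>Subtraction is truncated, so this rests on \<open>\<delta>\<close> dividing
      \<open>\<nu>\<close> coordinatewise; \<open>\<nu> - \<delta>\<close> is then the multiplier
      that produces \<open>m\<close>.\<close>
    moreover have "\<nu> - \<delta> + \<delta> = \<nu>"
      using exponent_lcm_le[OF k(3)[symmetric]] unfolding \<delta>_def by (rule exponent_diff_add)
    ultimately show "m \<in> generated_monomials (lm_set (schreyer_order lt s) F)"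
      unfolding m generated_monomials_def by (metis (mono_tags, lifting) CollectI)
  qed
  ultimately show ?thesis
    unfolding standard_basis_def
    using subspace_syz generated_monomials_lm_set_subset[OF S subspace_syz] by blast
qed

end
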